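(* Let $\mathbb{K}$ be a field, let $V$ be a vector space over $\mathbb{K}$ with finite positive dimension, and let $A,A^*$ be a sharp tridiagonal pair on $V$. Then there exists a nonzero bilinear form $\langle\,,\rangle$ on $V$ such that $\langle Au,v\rangle=\langle u,Av\rangle$ and $\langle A^*u,v\rangle=\langle u,A^*v\rangle$ for all $u,v\in V$. This form is unique up to multiplication by a nonzero scalar in $\mathbb{K}$. This form is nondegenerate and symmetric.
   Context: Let $\mathbb{K}$ be a field and $V$ a vector space over $\mathbb{K}$ with finite positive dimension. $\mathrm{End}(V)$ is the $\mathbb{K}$-algebra of all $\mathbb{K}$-linear maps $V\to V$. An eigenspace of $A\in\mathrm{End}(V)$ is a nonzero subspace of the form $\{v\in V\mid Av=\theta v\}$ with $\theta\in\mathbb{K}$; $A$ is diagonalizable if $V$ is spanned by the eigenspaces of $A$. A tridiagonal pair on $V$ is an ordered pair $A,A^*\in\mathrm{End}(V)$ (here $A^*$ is just a second linear map, not an adjoint) such that: (i) each of $A,A^*$ is diagonalizable; (ii) there is an ordering $\{V_i\}_{i=0}^d$ of the eigenspaces of $A$ with $A^*V_i\subseteq V_{i-1}+V_i+V_{i+1}$ for $0\le i\le d$, where $V_{-1}=0=V_{d+1}$; (iii) there is an ordering $\{V^*_i\}_{i=0}^\delta$ of the eigenspaces of $A^*$ with $AV^*_i\subseteq V^*_{i-1}+V^*_i+V^*_{i+1}$ for $0\le i\le\delta$, where $V^*_{-1}=0=V^*_{\delta+1}$; (iv) there is no subspace $W$ of $V$ with $AW\subseteq W$, $A^*W\subseteq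 W$, $W\ne0$, $W\ne V$. It is known that $d=\delta$ and that, for $0\le i\le d$, the spaces $V_i,V_{d-i},V^*_i,V^*_{d-i}$ have the same dimension, denoted $\rho_i$. The pair $A,A^*$ is called sharp if $\rho_0=1$. A bilinear form on $V$ is a map $V\times V\to\mathbb{K}$ that is $\mathbb{K}$-linear in each argument. It is degenerate if there is a nonzero $u\in V$ with $\langle u,v\rangle=0$ for all $v\in V$ (equivalently, a nonzero $v$ with $\langle u,v\rangle=0$ for all $u$), and nondegenerate otherwise. It is symmetric if $\langle u,v\rangle=\langle v,u\rangle$ for all $u,v\in V$. *)

theory Defs
  imports Complex_Main
begin

text \<open>The vector space is the whole type \<open>'v\<close> with scalar multiplication \<open>s\<close> over the field \<open>'k\<close>, as
  in the library locale \<^locale>\<open>vector_space\<close>. The qualified name \<open>Vector_Spaces.linear\<close> is the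
  library notion over an arbitrary field; plain \<open>linear\<close> is its instance over the reals.\<close>

type_synonym ('k, 'v) smult = "'k \<Rightarrow> 'v \<Rightarrow> 'v"

definition eigenspace ::
  "('k::field, 'v::ab_group_add) smult \<Rightarrow> ('v \<Rightarrow> 'v) \<Rightarrow> 'k \<Rightarrow> 'v set" where
  "eigenspace s A \<theta> = {v. A v = s \<theta> v}"

definition eigenspaces ::
  "('k::field, 'v::ab_group_add) smult \<Rightarrow> ('v \<Rightarrow> 'v) \<Rightarrow> 'v set set" where
  "eigenspaces s A = {eigenspace s A \<theta> | \<theta>. eigenspace s A \<theta> \<noteq> {0}}"

definition diagonalizable ::
  "('k::field, 'v::ab_group_add) smult \<Rightarrow> ('v \<Rightarrow> 'v) \<Rightarrow> bool" where
  "diagonalizable s A \<longleftrightarrow> module.span s (\<Union>(eigenspaces s A)) = UNIV"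

definition sum3 :: "'v::ab_group_add set \<Rightarrow> 'v set \<Rightarrow> 'v set \<Rightarrow> 'v set" where
  "sum3 X Y Z = {x + y + z | x y z. x \<in> X \<and> y \<in> Y \<and> z \<in> Z}"

text \<open>\<open>U 0, \<dots>, U d\<close> lists each eigenspace of \<open>A\<close> exactly once, and \<open>B\<close> acts on this ordering in
  a tridiagonal way. The conditionals encode the conventions that the spaces with index \<open>-1\<close> and
  \<open>d + 1\<close> are zero; values of \<open>U\<close> above \<open>d\<close> are irrelevant.\<close>

definition tridiagonal_ordering ::
  "('k::field, 'v::ab_group_add) smult \<Rightarrow> ('v \<Rightarrow> 'v) \<Rightarrow> ('v \<Rightarrow> 'v) \<Rightarrow> nat \<Rightarrow> (nat \<Rightarrow> 'v set) \<Rightarrow> bool"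
  where
  "tridiagonal_ordering s A B d U \<longleftrightarrow>
     bij_betw U {0..d} (eigenspaces s A) \<and>
     (\<forall>i\<le>d. B ` U i \<subseteq> sum3 (if i = 0 then {0} else U (i - 1))
                             (U i)
                             (if i = d then {0} else U (i + 1)))"

definition tridiagonal_pair ::
  "('k::field, 'v::ab_group_add) smult \<Rightarrow> ('v \<Rightarrow> 'v) \<Rightarrow> ('v \<Rightarrow> 'v) \<Rightarrow> bool" where
  "tridiagonal_pair s A B \<longleftrightarrow>
     Vector_Spaces.linear s s A \<and> Vector_Spaces.linear s s B \<and>
     diagonalizable s A \<and> diagonalizable s B \<and>
     (\<exists>d U. tridiagonal_ordering s A B d U) \<and>
     (\<exists>\<delta> U. tridiagonal_ordering s B A \<delta> U) \<and>
     \<not> (\<exists>W. module.subspace s W \<and> A ` W \<subseteq> W \<and> B ` W \<subseteq> W \<and> W \<noteq> {0} \<and> W \<noteq> UNIV)"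

text \<open>\<open>\<rho>\<^sub>0\<close> is the dimension of the first space of an ordering of the eigenspaces of \<open>A\<close>
  as in the definition of a tridiagonal pair. It does not depend on the choice of that ordering,
  so quantifying existentially over orderings is the same as fixing one.\<close>

definition sharp_tridiagonal_pair ::
  "('k::field, 'v::ab_group_add) smult \<Rightarrow> ('v \<Rightarrow> 'v) \<Rightarrow> ('v \<Rightarrow> 'v) \<Rightarrow> bool" where
  "sharp_tridiagonal_pair s A B \<longleftrightarrow>
     tridiagonal_pair s A B \<and>
     (\<exists>d U. tridiagonal_ordering s A B d U \<and> vector_space.dim s (U 0) = 1)"

definition bilinear_form ::
  "('k::field, 'v::ab_group_add) smult \<Rightarrow> ('v \<Rightarrow> 'v \<Rightarrow> 'k) \<Rightarrow> bool" where
  "bilinear_form s f \<longleftrightarrow>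
     (\<forall>v. Vector_Spaces.linear s (*) (\<lambda>u. f u v)) \<and>
     (\<forall>u. Vector_Spaces.linear s (*) (\<lambda>v. f u v))"

definition nondegenerate_form :: "('v::ab_group_add \<Rightarrow> 'v \<Rightarrow> 'k::field) \<Rightarrow> bool" where
  "nondegenerate_form f \<longleftrightarrow> \<not> (\<exists>u. u \<noteq> 0 \<and> (\<forall>v. f u v = 0))"

definition symmetric_form :: "('v \<Rightarrow> 'v \<Rightarrow> 'k) \<Rightarrow> bool" where
  "symmetric_form f \<longleftrightarrow> (\<forall>u v. f u v = f v u)"

definition self_adjoint_wrt :: "('v \<Rightarrow> 'v \<Rightarrow> 'k) \<Rightarrow> ('v \<Rightarrow> 'v) \<Rightarrow> bool" where
  "self_adjoint_wrt f A \<longleftrightarrow> (\<forall>u v. f (A u) v = f u (A v))"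

definition nonzero_invariant_form ::
  "('k::field, 'v::ab_group_add) smult \<Rightarrow> ('v \<Rightarrow> 'v) \<Rightarrow> ('v \<Rightarrow> 'v) \<Rightarrow> ('v \<Rightarrow> 'v \<Rightarrow> 'k) \<Rightarrow> bool" where
  "nonzero_invariant_form s A B f \<longleftrightarrow>
     bilinear_form s f \<and> (\<exists>u v. f u v \<noteq> 0) \<and> self_adjoint_wrt f A \<and> self_adjoint_wrt f B"

end

theory Submission
  imports Defs "HOL-Computational_Algebra.Polynomial"
begin

text \<open>Let \<open>E\<^sub>i\<close> and \<open>F\<^sub>i\<close> be the eigenprojections of \<open>A\<close> and \<open>A*\<close>, and write the rank one map
  \<open>E\<^sub>0\<close> as \<open>v \<mapsto> \<phi> v \<cdot> u\<close>. By irreducibility \<open>V\<close> is spanned by the vectors \<open>W u\<close> for words \<open>W\<close> in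
  \<open>A\<close> and \<open>A*\<close>, and \<open>\<langle>W u, v\<rangle> = \<phi> (W' v)\<close>, where \<open>W'\<close> is the reversed word, is a well-defined
  invariant form as soon as \<open>\<phi> (W u) = \<phi> (W' u)\<close> for all words. By linearity it suffices to treat
  alternating words \<open>E\<^bsub>x 0\<^esub> F\<^bsub>x 1\<^esub> E\<^bsub>x 2\<^esub> \<dots> E\<^bsub>x (2n)\<^esub>\<close> with \<open>x 0 = x (2n) = 0\<close>. Let \<open>z x\<close> be the difference
  of the two sides. If an interior even entry is \<open>0\<close>, the word splits at that rank one factor into
  two shorter ones, so \<open>z x = 0\<close> by induction. Tridiagonality says \<open>E\<^sub>a A*\<^sup>r E\<^sub>b = 0\<close> and
  \<open>F\<^sub>a A\<^sup>r F\<^sub>b = 0\<close> for \<open>r < \<bar>a - b\<bar>\<close>; hence \<open>z\<close>, as a function of the entry between \<open>a\<close> and \<open>b\<close>, is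
  orthogonal to the polynomials of degree below \<open>\<bar>a - b\<bar>\<close>, so that it vanishes or has more than
  \<open>\<bar>a - b\<bar>\<close> nonzero values. A finite nonempty set of sequences whose fibres are that large must have
  growing minima at the even positions, which contradicts \<open>x (2n) = 0\<close>.

  Uniqueness, nondegeneracy and symmetry hold because an invariant form \<open>f\<close> satisfies
  \<open>f u v = \<phi> v \<cdot> f u u\<close> and its radical is an invariant subspace.\<close>

section \<open>Sequences with large fibres\<close>

text \<open>The gap between entries \<open>0\<close> and \<open>2\<close> is carried along one
  position at a time, as a comparison of minima over \<open>S\<close> at positions \<open>k\<close>
  and \<open>k + 2\<close>. The induction varies \<open>S\<close> because it is applied to the slice
  \<open>T\<close> with entry \<open>k + 3\<close> fixed.\<close>

lemma fibre_growth:
  fixes S :: "(nat \<Rightarrow> nat) set"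
  assumes "x \<in> S"
    and bounded: "\<And>y p. y \<in> S \<Longrightarrow> p < Suc (Suc k) \<Longrightarrow> y p \<le> m"
    and fibres: "\<And>y p. y \<in> S \<Longrightarrow> p \<le> k \<Longrightarrow>
      \<bar>int (y p) - int (y (Suc (Suc p)))\<bar> < int (card {v. y(Suc p := v) \<in> S})"
    and start: "\<And>y. y \<in> S \<Longrightarrow> y 0 < y (Suc (Suc 0))"
  shows "\<exists>y\<in>S. y k < x (Suc (Suc k))"
  using assms
proof (induction k arbitrary: S x)
  case 0
  then show ?case by blast
next
  case (Suc k)
  let ?N = "Suc (Suc (Suc k))"
  define T where "T = {y \<in> S. y ?N = x ?N}"
  \<comment> \<open>The updated entry lies at position \<open>k + 2\<close> at most, so fixing entry
    \<open>k + 3\<close> removes nothing from these fibres.\<close>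
  have upd: "{v. y(Suc p := v) \<in> T} = {v. y(Suc p := v) \<in> S}" if "y \<in> T" "p \<le> Suc k" for y p
    using that by (auto simp: T_def)
  have IH: "\<exists>z\<in>T. z k < y (Suc (Suc k))" if "y \<in> T" for y
  proof (rule Suc.IH)
    show "y \<in> T" by fact
    show "z p \<le> m" if "z \<in> T" "p < Suc (Suc k)" for z p
      using that Suc.prems(2)[of z p] by (auto simp: T_def)
    show "\<bar>int (z p) - int (z (Suc (Suc p)))\<bar> < int (card {v. z(Suc p := v) \<in> T})"
      if "z \<in> T" "p \<le> k" for z p
      unfolding upd[OF that(1) le_SucI[OF that(2)]]
      by (rule Suc.prems(3)) (use that in \<open>auto simp: T_def\<close>)
    show "z 0 < z (Suc (Suc 0))" if "z \<in> T" for z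
      using that Suc.prems(4)[of z] by (auto simp: T_def)
  qed
  txt \<open>Otherwise, among the sequences whose entry \<open>k\<close> is minimal, one that maximizes the sum of its
    entries \<open>k + 1\<close> and \<open>k + 2\<close> violates one of the two fibre conditions at these entries.\<close>
  show ?case
  proof (rule ccontr)
    assume "\<not> ?thesis"
    then have low: "x ?N \<le> y (Suc k)" if "y \<in> T" for y
      using that by (auto simp: T_def not_less)
    have "x \<in> T" using Suc.prems(1) by (simp add: T_def)
    then obtain w where w: "w \<in> T" "\<And>y. y \<in> T \<Longrightarrow> w k \<le> y k"
      using ex_has_least_nat[of "\<lambda>y. y \<in> T" x "\<lambda>y. y k"] by blast
    have high: "w k < y (Suc (Suc k))" if "y \<in> T" for y
      using IH[OF that] w(2) by (meson le_less_trans)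
    define F where "F y \<longleftrightarrow> y \<in> T \<and> y k = w k" for y
    have "F w" using w(1) by (simp add: F_def)
    moreover have "\<forall>y. F y \<longrightarrow> y (Suc k) + y (Suc (Suc k)) < Suc (m + m)"
      using Suc.prems(2) by (auto simp: F_def T_def less_Suc_eq_le intro!: add_mono)
    ultimately obtain y where "F y"
      and max: "\<And>z. F z \<Longrightarrow> z (Suc k) + z (Suc (Suc k)) \<le> y (Suc k) + y (Suc (Suc k))"
      using ex_has_greatest_nat[of F w "\<lambda>y. y (Suc k) + y (Suc (Suc k))" "Suc (m + m)"] by auto
    then have y: "y \<in> T" "y k = w k" by (simp_all add: F_def)
    have "y \<in> S" using y by (simp add: T_def)
    have "{v. y(Suc k := v) \<in> T} \<subseteq> {x ?N..y (Suc k)}"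
      using max[of "y(Suc k := _)"] low[of "y(Suc k := _)"] y by (auto simp: F_def)
    from card_mono[OF _ this]
    have "int (card {v. y(Suc k := v) \<in> S}) \<le> int (Suc (y (Suc k)) - x ?N)"
      using upd[OF y(1), of k] by (simp del: fun_upd_apply)
    moreover have "\<bar>int (y k) - int (y (Suc (Suc k)))\<bar> < int (card {v. y(Suc k := v) \<in> S})"
      using Suc.prems(3)[OF \<open>y \<in> S\<close>, of k] by (simp del: fun_upd_apply)
    ultimately have 1: "int (y (Suc (Suc k))) - int (w k) \<le> int (y (Suc k)) - int (x ?N)"
      using low[OF y(1)] y(2) by linarith
    \<comment> \<open>The lower end \<open>w k\<close> is excluded because \<open>high\<close> is
      strict. Hence this fibre yields a strict inequality between the two differences that
      \<open>1\<close> compares weakly the other way round.\<close>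
    have "{v. y(Suc (Suc k) := v) \<in> T} \<subseteq> {Suc (w k)..y (Suc (Suc k))}"
      using max[of "y(Suc (Suc k) := _)"] high[of "y(Suc (Suc k) := _)"] y by (auto simp: F_def Suc_le_eq)
    from card_mono[OF _ this]
    have "int (card {v. y(Suc (Suc k) := v) \<in> S}) \<le> int (y (Suc (Suc k)) - w k)"
      using upd[OF y(1), of "Suc k"] by (simp del: fun_upd_apply)
    moreover have "\<bar>int (y (Suc k)) - int (y ?N)\<bar> < int (card {v. y(Suc (Suc k) := v) \<in> S})"
      using Suc.prems(3)[OF \<open>y \<in> S\<close>, of "Suc k"] by (simp del: fun_upd_apply)
    moreover have "y ?N = x ?N" using y by (simp add: T_def)
    ultimately have "int (y (Suc k)) - int (x ?N) < int (y (Suc (Suc k))) - int (w k)"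
      using high[OF y(1)] by linarith
    with 1 show False by simp
  qed
qed

text \<open>If the support had at most \<open>m\<close> points, the polynomial with simple roots at
  all of them except \<open>v\<close> would have degree below \<open>m\<close>. Its pairing with
  \<open>z\<close> is zero by the moments, yet equals the term at \<open>v\<close>, which is nonzero
  by injectivity of \<open>\<theta>\<close>.\<close>

lemma card_support_gt:
  fixes z \<theta> :: "nat \<Rightarrow> 'k::field"
  assumes inj: "inj_on \<theta> {..D}" and "v \<le> D" "z v \<noteq> 0"
    and moments: "\<And>r. int r < m \<Longrightarrow> (\<Sum>i\<le>D. \<theta> i ^ r * z i) = 0"
  shows "m < int (card {i. i \<le> D \<and> z i \<noteq> 0})"
proof (rule ccontr)
  let ?S = "{i. i \<le> D \<and> z i \<noteq> 0}"
  assume "\<not> ?thesis"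
  moreover have fin: "finite ?S" by simp
  moreover have vS: "v \<in> ?S" using assms by simp
  ultimately have le: "int (card (?S - {v})) < m"
    by (smt (verit) card_Diff1_less of_nat_less_iff)
  define p where "p = (\<Prod>i\<in>?S - {v}. [:- \<theta> i, 1:])"
  have "degree p \<le> card (?S - {v})"
    unfolding p_def by (rule order.trans[OF degree_prod_sum_le]) auto
  then have deg: "int r < m" if "r \<le> degree p" for r using that le by linarith
  have "(\<Sum>i\<le>D. poly p (\<theta> i) * z i) = (\<Sum>i\<le>D. \<Sum>r\<le>degree p. coeff p r * (\<theta> i ^ r * z i))"
    by (simp add: poly_altdef sum_distrib_right mult.assoc)
  also have "\<dots> = (\<Sum>r\<le>degree p. coeff p r * (\<Sum>i\<le>D. \<theta> i ^ r * z i))"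
    by (subst sum.swap) (simp add: sum_distrib_left)
  also have "\<dots> = 0" using moments deg by (intro sum.neutral) auto
  finally have "(\<Sum>i\<le>D. poly p (\<theta> i) * z i) = 0" .
  moreover have "(\<Sum>i\<in>{..D} - {v}. poly p (\<theta> i) * z i) = 0"
    using fin by (intro sum.neutral) (auto simp: p_def poly_prod)
  then have "(\<Sum>i\<le>D. poly p (\<theta> i) * z i) = poly p (\<theta> v) * z v"
    using \<open>v \<le> D\<close> by (subst sum.remove[of _ v]) auto
  moreover have "poly p (\<theta> v) \<noteq> 0"
    using inj \<open>v \<le> D\<close> fin by (auto simp: p_def poly_prod inj_on_def)
  ultimately show False using \<open>z v \<noteq> 0\<close> by simp
qed

section \<open>Reversal of words\<close>

text \<open>The index \<open>True\<close> belongs to \<open>A\<close> and \<open>False\<close> to \<open>A*\<close>; \<open>P b i\<close> is the projection onto the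
  eigenspace of \<open>X b\<close> for \<open>\<theta> b i\<close>.\<close>

locale tridiagonal_system = vector_space scale
  for scale :: "'k::field \<Rightarrow> 'v::ab_group_add \<Rightarrow> 'v" +
  fixes X :: "bool \<Rightarrow> 'v \<Rightarrow> 'v"
    and P :: "bool \<Rightarrow> nat \<Rightarrow> 'v \<Rightarrow> 'v"
    and D :: "bool \<Rightarrow> nat"
    and \<theta> :: "bool \<Rightarrow> nat \<Rightarrow> 'k"
    and u :: 'v and \<phi> :: "'v \<Rightarrow> 'k"
  assumes X_hom: "module_hom scale scale (X b)"
    and P_hom: "module_hom scale scale (P b i)"
    and \<phi>_hom: "module_hom scale (*) \<phi>"
    and inj_\<theta>: "inj_on (\<theta> b) {..D b}"
    and sum_P: "(\<Sum>i\<le>D b. P b i v) = v"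
    and X_P: "i \<le> D b \<Longrightarrow> X b (P b i v) = scale (\<theta> b i) (P b i v)"
    and P_P: "i \<le> D b \<Longrightarrow> j \<le> D b \<Longrightarrow> i \<noteq> j \<Longrightarrow> P b i (P b j v) = 0"
    and tridiagonal: "i \<le> D b \<Longrightarrow> j \<le> D b \<Longrightarrow> 1 < \<bar>int i - int j\<bar> \<Longrightarrow> P b i (X (\<not> b) (P b j v)) = 0"
    and P_rank_one: "P True 0 v = scale (\<phi> v) u"
    and \<phi>_u: "\<phi> u = 1"
begin

lemmas X_add = module_hom.add[OF X_hom] and X_scale = module_hom.scale[OF X_hom]
  and X_sum = module_hom.sum[OF X_hom] and X_zero = module_hom.zero[OF X_hom]
lemmas P_scale = module_hom.scale[OF P_hom]
  and P_sum = module_hom.sum[OF P_hom] and P_zero = module_hom.zero[OF P_hom]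
lemmas \<phi>_add = module_hom.add[OF \<phi>_hom] and \<phi>_scale = module_hom.scale[OF \<phi>_hom]
  and \<phi>_sum = module_hom.sum[OF \<phi>_hom] and \<phi>_zero = module_hom.zero[OF \<phi>_hom]

section \<open>Words in the generators and in the projections\<close>

fun X_word :: "bool list \<Rightarrow> 'v \<Rightarrow> 'v" where
  "X_word [] v = v"
| "X_word (b # bs) v = X b (X_word bs v)"

text \<open>Alternating words suffice, since each generator is a combination of products of one
  projection from each family (\<open>X_eq_double_sum\<close>).\<close>

fun P_word :: "bool \<Rightarrow> nat list \<Rightarrow> 'v \<Rightarrow> 'v" where
  "P_word b [] v = v"
| "P_word b (i # is) v = P b i (P_word (\<not> b) is v)"

lemma X_word_append: "X_word (bs @ cs) v = X_word bs (X_word cs v)"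
  by (induction bs) auto

lemma X_word_hom: "module_hom scale scale (X_word bs)"
proof (induction bs)
  case Nil
  show ?case using module_hom_ident by (simp add: module_hom_iff module_axioms)
next
  case (Cons b bs)
  then show ?case by (simp add: module_hom_iff X_add X_scale)
qed

lemmas X_word_add = module_hom.add[OF X_word_hom] and X_word_scale = module_hom.scale[OF X_word_hom]
  and X_word_sum = module_hom.sum[OF X_word_hom]

text \<open>The inequality of booleans is exclusive or: the family flips once per letter of
  \<open>xs\<close>.\<close>

lemma P_word_append:
  "P_word b (xs @ ys) v = P_word b xs (P_word (b \<noteq> odd (length xs)) ys v)"
proof (induction xs arbitrary: b)
  case (Cons x xs)
  then show ?case by (cases b) simp_all
qed simp

lemma P_word_scale: "P_word b xs (scale c v) = scale c (P_word b xs v)"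
  by (induction xs arbitrary: b) (simp_all add: P_scale)

lemma P_word_zero: "P_word b xs 0 = 0"
  by (induction xs arbitrary: b) (simp_all add: P_zero)

lemma P_word_sum: "P_word b xs (\<Sum>i\<in>I. f i) = (\<Sum>i\<in>I. P_word b xs (f i))"
  by (induction xs arbitrary: b) (simp_all add: P_sum)

section \<open>Spectral expansions and moments\<close>

lemma X_eq: "X b v = (\<Sum>i\<le>D b. scale (\<theta> b i) (P b i v))"
proof -
  have "X b v = X b (\<Sum>i\<le>D b. P b i v)" by (simp add: sum_P)
  also have "\<dots> = (\<Sum>i\<le>D b. scale (\<theta> b i) (P b i v))"
    unfolding X_sum by (rule sum.cong) (auto simp: X_P)
  finally show ?thesis .
qed

lemma X_power_eq: "(X b ^^ r) v = (\<Sum>i\<le>D b. scale (\<theta> b i ^ r) (P b i v))"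
proof (induction r)
  case 0
  show ?case by (simp add: sum_P)
next
  case (Suc r)
  have "(X b ^^ Suc r) v = (\<Sum>i\<le>D b. scale (\<theta> b i ^ r) (X b (P b i v)))"
    by (simp add: Suc X_sum X_scale)
  also have "\<dots> = (\<Sum>i\<le>D b. scale (\<theta> b i ^ Suc r) (P b i v))"
    by (rule sum.cong) (auto simp: X_P mult.commute)
  finally show ?case .
qed

text \<open>Each factor moves the eigenspace index by at most one, so \<open>r\<close> factors
  cannot bridge a larger distance. The induction inserts the sum of all projections behind the
  leftmost factor.\<close>

lemma P_X_power_P:
  assumes "i \<le> D b" "j \<le> D b" "int r < \<bar>int i - int j\<bar>"
  shows "P b i ((X (\<not> b) ^^ r) (P b j v)) = 0"
  using assms
proof (induction r arbitrary: i)
  case 0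
  then show ?case by (auto simp: P_P)
next
  case (Suc r)
  have "P b i ((X (\<not> b) ^^ Suc r) (P b j v))
      = P b i (X (\<not> b) (\<Sum>l\<le>D b. P b l ((X (\<not> b) ^^ r) (P b j v))))"
    by (simp add: sum_P)
  also have "\<dots> = (\<Sum>l\<le>D b. P b i (X (\<not> b) (P b l ((X (\<not> b) ^^ r) (P b j v)))))"
    by (simp add: P_sum X_sum)
  also have "\<dots> = 0"
  proof (intro sum.neutral ballI)
    fix l assume l: "l \<in> {..D b}"
    show "P b i (X (\<not> b) (P b l ((X (\<not> b) ^^ r) (P b j v)))) = 0"
    proof (cases "1 < \<bar>int i - int l\<bar>")
      case True
      with l Suc.prems show ?thesis by (simp add: tridiagonal)
    next
      case False
      with Suc.prems have "int r < \<bar>int l - int j\<bar>" by simp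
      with Suc.IH[of l] l Suc.prems show ?thesis by (simp add: X_zero P_zero)
    qed
  qed
  finally show ?case .
qed

text \<open>Weighting the middle letter by \<open>r\<close>-th powers of eigenvalues rebuilds an
  \<open>r\<close>-th power of the generator between the letters \<open>i\<close> and
  \<open>j\<close>, and \<open>P_X_power_P\<close> applies. Here \<open>c\<close> is the family of
  these two letters.\<close>

lemma P_word_moment:
  fixes b xs
  defines "c \<equiv> (b \<noteq> odd (length xs))"
  assumes "i \<le> D c" "j \<le> D c" "int r < \<bar>int i - int j\<bar>"
  shows "(\<Sum>l\<le>D (\<not> c). scale (\<theta> (\<not> c) l ^ r) (P_word b (xs @ [i, l, j] @ ys) v)) = 0"
proof -
  let ?w = "P c j (P_word (\<not> c) ys v)"
  have "P_word b (xs @ [i, l, j] @ ys) v = P_word b xs (P c i (P (\<not> c) l ?w))" for l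
    by (subst P_word_append) (simp add: c_def)
  then have "(\<Sum>l\<le>D (\<not> c). scale (\<theta> (\<not> c) l ^ r) (P_word b (xs @ [i, l, j] @ ys) v))
      = P_word b xs (P c i ((X (\<not> c) ^^ r) ?w))"
    by (simp add: X_power_eq P_word_sum P_word_scale P_sum P_scale)
  also have "\<dots> = 0" using assms(2-) by (simp add: P_X_power_P P_word_zero)
  finally show ?thesis .
qed

text \<open>The difference called \<open>z\<close> in the outline. For odd length the last letter is
  again in family \<open>True\<close>, so the reversed list does denote the reversed word.\<close>

definition asym :: "nat list \<Rightarrow> 'k" where
  "asym xs = \<phi> (P_word True xs u) - \<phi> (P_word True (rev xs) u)"

text \<open>Equal parity of the two outer lists keeps \<open>i\<close> and \<open>j\<close> in
  family \<open>c\<close> after reversal, so both terms of the difference have vanishing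
  moments.\<close>

lemma asym_moment:
  fixes xs
  defines "c \<equiv> even (length xs)"
  assumes "i \<le> D c" "j \<le> D c" "int r < \<bar>int i - int j\<bar>"
    and parity: "even (length xs) \<longleftrightarrow> even (length ys)"
  shows "(\<Sum>l\<le>D (\<not> c). \<theta> (\<not> c) l ^ r * asym (xs @ [i, l, j] @ ys)) = 0"
proof -
  have "(\<Sum>l\<le>D (\<not> c). \<theta> (\<not> c) l ^ r * asym (xs @ [i, l, j] @ ys))
    = \<phi> (\<Sum>l\<le>D (\<not> c). scale (\<theta> (\<not> c) l ^ r) (P_word True (xs @ [i, l, j] @ ys) u))
    - \<phi> (\<Sum>l\<le>D (\<not> c). scale (\<theta> (\<not> c) l ^ r) (P_word True (rev ys @ [j, l, i] @ rev xs) u))"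
    by (simp add: asym_def \<phi>_sum \<phi>_scale right_diff_distrib sum_subtractf)
  also have "\<dots> = 0"
    using P_word_moment[of i True xs j r ys u] P_word_moment[of j True "rev ys" i r "rev xs" u]
      assms(2-) by (simp add: c_def \<phi>_zero abs_minus_commute)
  finally show ?thesis .
qed

section \<open>End letters and splitting at the rank one projection\<close>

lemma P_u: "P True 0 u = u"
  by (simp add: P_rank_one \<phi>_u)

lemma P_u_eq_0: "j \<le> D True \<Longrightarrow> j \<noteq> 0 \<Longrightarrow> P True j u = 0"
  using P_P[of j True 0 u] by (simp add: P_u)

lemma \<phi>_P: "\<phi> (P True 0 v) = \<phi> v"
  by (simp add: P_rank_one \<phi>_u \<phi>_scale)

lemma \<phi>_P_eq_0:
  assumes "j \<le> D True" "j \<noteq> 0"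
  shows "\<phi> (P True j v) = 0"
  using \<phi>_P[of "P True j v"] P_P[of 0 True j v] assms by (simp add: \<phi>_zero)

lemma \<phi>_P_word_split:
  assumes "even (length xs)"
  shows "\<phi> (P_word True (xs @ 0 # ys) u)
    = \<phi> (P_word True (xs @ [0]) u) * \<phi> (P_word True (0 # ys) u)"
  using assms
  by (simp add: P_word_append P_rank_one P_word_scale \<phi>_scale \<phi>_u)

text \<open>Both the word and its reversal factor at the letter \<open>0\<close>. Reversal swaps the
  two scalar factors, which commute.\<close>

lemma asym_split:
  assumes "even (length xs)" "even (length ys)" "asym (xs @ [0]) = 0" "asym (0 # ys) = 0"
  shows "asym (xs @ 0 # ys) = 0"
  using assms(3,4) \<phi>_P_word_split[OF assms(1), of ys] \<phi>_P_word_split[of "rev ys" "rev xs"]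
    assms(2) by (simp add: asym_def)

text \<open>The functional \<open>\<phi>\<close> kills the image of the letter \<open>i\<close>, and
  in the reversed word that letter kills \<open>u\<close>.\<close>

lemma asym_first:
  assumes "even (length xs)" "i \<le> D True" "i \<noteq> 0"
  shows "asym (i # xs) = 0"
  using assms by (simp add: asym_def P_word_append \<phi>_P_eq_0 P_u_eq_0 P_word_zero \<phi>_zero)

lemma asym_rev: "asym (rev xs) = - asym xs"
  by (simp add: asym_def)

lemma asym_last:
  assumes "even (length xs)" "i \<le> D True" "i \<noteq> 0"
  shows "asym (xs @ [i]) = 0"
  using asym_first[of "rev xs" i] asym_rev[of "xs @ [i]"] assms by simp

text \<open>The argument studies the set \<open>S\<close> of all counterexamples for one
  \<open>n\<close>. Index sequences are functions so that fibres become function updates, as in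
  \<open>fibre_growth\<close>.\<close>

lemma asym_map_eq_0:
  assumes "\<And>p. p \<le> 2 * n \<Longrightarrow> x p \<le> D (even p)"
  shows "asym (map x [0..<Suc (2 * n)]) = 0"
  using assms
proof (induction n arbitrary: x rule: less_induct)
  case (less n)
  define z where "z x = asym (map x [0..<Suc (2 * n)])" for x
  define S where "S = {x. (\<forall>p\<le>2 * n. x p \<le> D (even p)) \<and> z x \<noteq> 0}"
  have split: "[0..<Suc (2 * n)] = [0..<p] @ p # [Suc p..<Suc (2 * n)]" if "p \<le> 2 * n" for p
    using that upt_add_eq_append[of 0 p "Suc (2 * n) - p"] upt_conv_Cons[of p "Suc (2 * n)"] by simp
  have first: "x 0 = 0" if "x \<in> S" for x
  proof (rule ccontr)
    assume "x 0 \<noteq> 0"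
    moreover have "x 0 \<le> D True" using that by (auto simp: S_def)
    ultimately have "z x = 0" unfolding z_def using split[of 0] by (simp add: asym_first)
    with that show False by (simp add: S_def)
  qed
  have last: "x (2 * n) = 0" if "x \<in> S" for x
  proof (rule ccontr)
    assume "x (2 * n) \<noteq> 0"
    moreover have "x (2 * n) \<le> D True" using that by (auto simp: S_def)
    ultimately have "z x = 0" unfolding z_def by (simp add: asym_last)
    with that show False by (simp add: S_def)
  qed
  have interior: "x (2 * m) \<noteq> 0" if "x \<in> S" "0 < m" "m < n" for x m
  proof
    assume 0: "x (2 * m) = 0"
    have "asym (map x [0..<Suc (2 * m)]) = 0"
      by (rule less.IH) (use that in \<open>auto simp: S_def\<close>)
    moreover have "map x [0..<Suc (2 * m)] = map x [0..<2 * m] @ [0]"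
      using 0 by (simp add: upt_Suc_append[of 0 "2 * m"] del: upt_Suc)
    ultimately have left: "asym (map x [0..<2 * m] @ [0]) = 0" by metis
    \<comment> \<open>The shift is even, so every letter of the suffix keeps its family.\<close>
    have "asym (map (\<lambda>p. x (p + 2 * m)) [0..<Suc (2 * (n - m))]) = 0"
    proof (rule less.IH)
      show "n - m < n" using that by simp
      fix p assume "p \<le> 2 * (n - m)"
      then have "p + 2 * m \<le> 2 * n" using that(3) by simp
      then have "x (p + 2 * m) \<le> D (even (p + 2 * m))" using that(1) unfolding S_def by blast
      then show "x (p + 2 * m) \<le> D (even p)" by simp
    qed
    moreover have "Suc (2 * (n - m)) + 2 * m = Suc (2 * n)" using that(3) by simp
    then have upt: "[2 * m..<Suc (2 * n)] = map (\<lambda>p. p + 2 * m) [0..<Suc (2 * (n - m))]"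
      by (metis map_add_upt)
    have "map (\<lambda>p. x (p + 2 * m)) [0..<Suc (2 * (n - m))] = map x [2 * m..<Suc (2 * n)]"
      unfolding upt by (simp add: comp_def del: upt_Suc)
    moreover have "map x [2 * m..<Suc (2 * n)] = 0 # map x [Suc (2 * m)..<Suc (2 * n)]"
      using 0 that(3) by (simp add: upt_conv_Cons[of "2 * m"] del: upt_Suc)
    ultimately have right: "asym (0 # map x [Suc (2 * m)..<Suc (2 * n)]) = 0" by metis
    have "asym (map x [0..<2 * m] @ 0 # map x [Suc (2 * m)..<Suc (2 * n)]) = 0"
      by (rule asym_split[OF _ _ left right]) (use that(3) in simp_all)
    then have "z x = 0"
      unfolding z_def using split[of "2 * m"] that(3) 0 by (simp del: upt_Suc)
    with that(1) show False by (simp add: S_def)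
  qed
  have fibres: "\<bar>int (x p) - int (x (Suc (Suc p)))\<bar> < int (card {v. x(Suc p := v) \<in> S})"
    if x: "x \<in> S" and p: "Suc (Suc p) \<le> 2 * n" for x p
  proof -
    let ?c = "even p"
    let ?xs = "map x [0..<p]" and ?ys = "map x [Suc (Suc (Suc p))..<Suc (2 * n)]"
    have z: "z (x(Suc p := v)) = asym (?xs @ [x p, v, x (Suc (Suc p))] @ ?ys)" for v
    proof -
      have "[0..<Suc (2 * n)] = [0..<p] @ [p, Suc p, Suc (Suc p)] @ [Suc (Suc (Suc p))..<Suc (2 * n)]"
        using split[of p] p by (simp add: upt_conv_Cons del: upt_Suc)
      then show ?thesis unfolding z_def by (simp del: upt_Suc)
    qed
    \<comment> \<open>The support bound is applied to the entry between \<open>x p\<close> and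
      \<open>x (p + 2)\<close>, with their distance as the number of vanishing moments.\<close>
    have "\<bar>int (x p) - int (x (Suc (Suc p)))\<bar>
      < int (card {v. v \<le> D (\<not> ?c) \<and> asym (?xs @ [x p, v, x (Suc (Suc p))] @ ?ys) \<noteq> 0})"
    proof (rule card_support_gt)
      show "inj_on (\<theta> (\<not> ?c)) {..D (\<not> ?c)}" by (rule inj_\<theta>)
      show "x (Suc p) \<le> D (\<not> ?c)" using x p by (auto simp: S_def dest!: spec[of _ "Suc p"])
      show "asym (?xs @ [x p, x (Suc p), x (Suc (Suc p))] @ ?ys) \<noteq> 0"
        using x z[of "x (Suc p)"] by (simp add: S_def)
      show "(\<Sum>v\<le>D (\<not> ?c). \<theta> (\<not> ?c) v ^ r * asym (?xs @ [x p, v, x (Suc (Suc p))] @ ?ys)) = 0"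
        if "int r < \<bar>int (x p) - int (x (Suc (Suc p)))\<bar>" for r
      proof -
        have "x p \<le> D ?c" "x (Suc (Suc p)) \<le> D ?c"
          using x p by (auto simp: S_def dest: spec[of _ "Suc (Suc p)"] spec[of _ p])
        with asym_moment[of "x p" ?xs "x (Suc (Suc p))" r ?ys] that p show ?thesis by (simp del: upt_Suc)
      qed
    qed
    also have "{v. v \<le> D (\<not> ?c) \<and> asym (?xs @ [x p, v, x (Suc (Suc p))] @ ?ys) \<noteq> 0}
      = {v. x(Suc p := v) \<in> S}"
      using x p by (auto simp: S_def z dest: spec[of _ "Suc p"])
    finally show ?thesis .
  qed
  show ?case
  proof (rule ccontr)
    assume "asym (map x [0..<Suc (2 * n)]) \<noteq> 0"
    then have x: "x \<in> S" using less.prems by (simp add: S_def z_def)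
    \<comment> \<open>For \<open>n = 0\<close> and, since both end entries are \<open>0\<close>,
      also for \<open>n = 1\<close>, the index list is a palindrome.\<close>
    have "n \<noteq> 0"
    proof
      assume "n = 0"
      then show False using x by (simp add: S_def z_def asym_def)
    qed
    moreover have "n \<noteq> 1"
    proof
      assume n: "n = 1"
      then show False using x first[OF x] last[OF x]
        by (simp add: S_def z_def asym_def numeral_2_eq_2)
    qed
    ultimately obtain k where k: "n = Suc (Suc k)" by (metis One_nat_def not0_implies_Suc)
    \<comment> \<open>The right-hand entry is \<open>x (2 * n) = 0\<close>, which no natural number
      undercuts. The initial gap holds because entry \<open>0\<close> is zero and the interior entry
      \<open>2\<close> is not.\<close>
    have "\<exists>y\<in>S. y (2 * Suc k) < x (Suc (Suc (2 * Suc k)))"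
    proof (rule fibre_growth)
      show "y p \<le> max (D True) (D False)" if "y \<in> S" "p < Suc (Suc (2 * Suc k))" for y p
      proof -
        have "y p \<le> D (even p)" using that k by (auto simp: S_def)
        then show ?thesis by (cases "even p") auto
      qed
      show "y 0 < y (Suc (Suc 0))" if "y \<in> S" for y
        using first[OF that] interior[OF that, of 1] k by (simp add: numeral_2_eq_2)
    qed (use x k in \<open>auto intro!: fibres\<close>)
    then show False using last[OF x] k by simp
  qed
qed

lemma asym_eq_0:
  assumes "odd (length xs)" "\<And>p. p < length xs \<Longrightarrow> xs ! p \<le> D (even p)"
  shows "asym xs = 0"
proof -
  obtain n where n: "length xs = Suc (2 * n)" using assms(1) by (auto elim: oddE)
  then have "asym (map ((!) xs) [0..<Suc (2 * n)]) = 0"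
    using assms(2) by (intro asym_map_eq_0) simp
  then show ?thesis using n by (metis map_nth)
qed

text \<open>The identity is inserted as the sum of the other family's projections, on either side.
  Having the same coefficients for both orders of the product makes the expansion compatible with
  reversal.\<close>

lemma X_eq_double_sum:
  obtains c where "\<And>v. X b v = (\<Sum>i\<le>D False. \<Sum>j\<le>D True. scale (c i j) (P False i (P True j v)))"
    and "\<And>v. X b v = (\<Sum>i\<le>D False. \<Sum>j\<le>D True. scale (c i j) (P True j (P False i v)))"
proof
  let ?c = "\<lambda>i j. if b then \<theta> True j else \<theta> False i"
  fix v
  have "(\<Sum>i\<le>D False. \<Sum>j\<le>D True. scale (?c i j) (P False i (P True j v)))
    = (if b then \<Sum>i\<le>D False. P False i (\<Sum>j\<le>D True. scale (\<theta> True j) (P True j v))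
       else \<Sum>i\<le>D False. scale (\<theta> False i) (P False i (\<Sum>j\<le>D True. P True j v)))"
    by (simp add: P_sum P_scale scale_sum_right)
  then show "X b v = (\<Sum>i\<le>D False. \<Sum>j\<le>D True. scale (?c i j) (P False i (P True j v)))"
    by (simp add: sum_P flip: X_eq)
  have "(\<Sum>i\<le>D False. \<Sum>j\<le>D True. scale (?c i j) (P True j (P False i v)))
    = (\<Sum>j\<le>D True. \<Sum>i\<le>D False. scale (?c i j) (P True j (P False i v)))"
    by (rule sum.swap)
  also have "\<dots>
    = (if b then \<Sum>j\<le>D True. scale (\<theta> True j) (P True j (\<Sum>i\<le>D False. P False i v))
       else \<Sum>j\<le>D True. P True j (\<Sum>i\<le>D False. scale (\<theta> False i) (P False i v)))"
    by (simp add: P_sum P_scale scale_sum_right)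
  finally show "X b v = (\<Sum>i\<le>D False. \<Sum>j\<le>D True. scale (?c i j) (P True j (P False i v)))"
    by (simp add: sum_P flip: X_eq)
qed

text \<open>Generators are peeled off one by one, each turning into two projection letters appended
  to \<open>xs\<close>, whose length stays odd. The first order of the product expands on the left,
  the second recombines on the right; the base case is \<open>asym_eq_0\<close>.\<close>

lemma \<phi>_X_word_rev_aux:
  assumes "odd (length xs)" "\<And>p. p < length xs \<Longrightarrow> xs ! p \<le> D (even p)"
  shows "\<phi> (P_word True xs (X_word bs u)) = \<phi> (X_word (rev bs) (P_word True (rev xs) u))"
  using assms
proof (induction bs arbitrary: xs)
  case Nil
  then show ?case using asym_eq_0[of xs] by (simp add: asym_def)
next
  case (Cons b bs)
  obtain c where c: "\<And>v. X b v = (\<Sum>i\<le>D False. \<Sum>j\<le>D True. scale (c i j) (P False i (P True j v)))"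
    "\<And>v. X b v = (\<Sum>i\<le>D False. \<Sum>j\<le>D True. scale (c i j) (P True j (P False i v)))"
    using X_eq_double_sum[of b] by blast
  have "\<phi> (P_word True xs (X_word (b # bs) u))
    = (\<Sum>i\<le>D False. \<Sum>j\<le>D True. c i j * \<phi> (P_word True (xs @ [i, j]) (X_word bs u)))"
    using Cons.prems(1)
    by (simp add: c(1) P_word_append P_word_sum P_word_scale \<phi>_sum \<phi>_scale)
  also have "\<dots> = (\<Sum>i\<le>D False. \<Sum>j\<le>D True.
      c i j * \<phi> (X_word (rev bs) (P_word True (rev (xs @ [i, j])) u)))"
  proof (intro sum.cong refl arg_cong2[where f = "(*)"] Cons.IH)
    fix i j p assume "i \<in> {..D False}" "j \<in> {..D True}" "p < length (xs @ [i, j])"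
    then show "(xs @ [i, j]) ! p \<le> D (even p)"
      using Cons.prems by (cases "p < length xs") (auto simp: nth_append nth_Cons' less_Suc_eq)
  qed (use Cons.prems in auto)
  also have "\<dots> = \<phi> (X_word (rev (b # bs)) (P_word True (rev xs) u))"
    by (simp add: X_word_append c(2) X_word_sum X_word_scale \<phi>_sum \<phi>_scale)
  finally show ?case .
qed

theorem \<phi>_X_word_rev: "\<phi> (X_word (rev bs) u) = \<phi> (X_word bs u)"
  using \<phi>_X_word_rev_aux[of "[0]" bs] by (simp add: \<phi>_P P_u)

end

section \<open>Invariant forms\<close>

lemma bilinear_form_iff:
  assumes "vector_space s"
  shows "bilinear_form s f \<longleftrightarrow>
    (\<forall>x y z. f (x + y) z = f x z + f y z) \<and> (\<forall>c x z. f (s c x) z = c * f x z) \<and>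
    (\<forall>x y z. f z (x + y) = f z x + f z y) \<and> (\<forall>c x z. f z (s c x) = c * f z x)"
proof -
  interpret vector_space s by fact
  have "vector_space ((*) :: 'a \<Rightarrow> 'a \<Rightarrow> 'a)"
    by unfold_locales (simp_all add: algebra_simps)
  then show ?thesis
    using assms by (simp add: bilinear_form_def Vector_Spaces.linear_iff) blast
qed

context tridiagonal_system
begin

definition invariant_form :: "('v \<Rightarrow> 'v \<Rightarrow> 'k) \<Rightarrow> bool" where
  "invariant_form f \<longleftrightarrow> bilinear_form scale f \<and> (\<forall>b. self_adjoint_wrt f (X b))"

lemma invariant_form_iff:
  "invariant_form f \<longleftrightarrow>
    (\<forall>x y z. f (x + y) z = f x z + f y z) \<and> (\<forall>c x z. f (scale c x) z = c * f x z) \<and>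
    (\<forall>x y z. f z (x + y) = f z x + f z y) \<and> (\<forall>c x z. f z (scale c x) = c * f z x) \<and>
    (\<forall>b x y. f (X b x) y = f x (X b y))"
  unfolding invariant_form_def self_adjoint_wrt_def bilinear_form_iff[OF vector_space_axioms] by auto

text \<open>Eigenvectors of \<open>X True\<close> for distinct eigenvalues are orthogonal, so only
  the component \<open>P True 0 v\<close> contributes.\<close>

lemma invariant_form_u:
  assumes "invariant_form f"
  shows "f u v = \<phi> v * f u u"
proof -
  note f = assms[unfolded invariant_form_iff]
  have zero: "f u 0 = 0" using f by (metis mult_zero_left scale_zero_left)
  have orth: "f u (P True j v) = 0" if "j \<le> D True" "j \<noteq> 0" for j
  proof -
    have "\<theta> True j * f u (P True j v) = f u (X True (P True j v))" using f that by (simp add: X_P)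
    also have "\<dots> = f (X True (P True 0 u)) (P True j v)" using f by (simp add: P_u)
    also have "\<dots> = \<theta> True 0 * f u (P True j v)" using f X_P[of 0 True u] by (simp add: P_u)
    finally show ?thesis using inj_\<theta>[of True] that by (auto simp: inj_on_def)
  qed
  have sum: "f u (\<Sum>i\<in>I. g i) = (\<Sum>i\<in>I. f u (g i))" for I :: "nat set" and g
    by (induction I rule: infinite_finite_induct) (use f zero in simp_all)
  have "f u v = f u (\<Sum>i\<le>D True. P True i v)" by (simp add: sum_P)
  also have "\<dots> = (\<Sum>i\<le>D True. if i = 0 then f u (P True 0 v) else 0)"
    unfolding sum by (rule sum.cong) (auto simp: orth)
  also have "\<dots> = \<phi> v * f u u" using f by (simp add: P_rank_one)
  finally show ?thesis .
qed

end

locale irreducible_tridiagonal_system = tridiagonal_system +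
  assumes irreducible: "subspace W \<Longrightarrow> (\<And>b. X b ` W \<subseteq> W) \<Longrightarrow> W = {0} \<or> W = UNIV"
begin

section \<open>Consequences of irreducibility\<close>

lemma u_nonzero: "u \<noteq> 0"
  using \<phi>_u \<phi>_zero by auto

lemma invariant_form_nondegenerate:
  assumes f: "invariant_form f" and "f x y \<noteq> 0"
  shows "nondegenerate_form f"
proof -
  let ?W = "{x. \<forall>y. f x y = 0}"
  note f = f[unfolded invariant_form_iff]
  have "f 0 z = 0" for z using f by (metis mult_zero_left scale_zero_left)
  then have "subspace ?W" using f by (auto intro!: subspaceI)
  moreover have "X b ` ?W \<subseteq> ?W" for b using f by auto
  moreover have "?W \<noteq> UNIV" using assms(2) by blast
  ultimately have "?W = {0}" using irreducible by blast
  then show ?thesis unfolding nondegenerate_form_def by blast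
qed

text \<open>By \<open>invariant_form_u\<close>, the nonzero vector \<open>u\<close> lies in the
  radical. This is applied to a form minus its transpose for symmetry and to
  \<open>g - c * f\<close> for uniqueness.\<close>

lemma invariant_form_eq_0:
  assumes "invariant_form f" "f u u = 0"
  shows "f x y = 0"
  using invariant_form_nondegenerate[OF assms(1)] invariant_form_u[OF assms(1)] assms(2) u_nonzero
  unfolding nondegenerate_form_def by (metis mult_zero_right)

lemma invariant_form_symmetric:
  assumes "invariant_form f"
  shows "f x y = f y x"
proof -
  have "invariant_form (\<lambda>x y. f x y - f y x)"
    using assms unfolding invariant_form_iff by (simp add: algebra_simps)
  from invariant_form_eq_0[OF this] show ?thesis by simp
qed

lemma invariant_form_unique:
  assumes f: "invariant_form f" and g: "invariant_form g" and "f x y \<noteq> 0"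
  shows "g v w = g u u / f u u * f v w"
proof -
  have "f u u \<noteq> 0" using invariant_form_eq_0[OF f] assms(3) by blast
  define c where "c = g u u / f u u"
  have "invariant_form (\<lambda>x y. g x y - c * f x y)"
    using f g unfolding invariant_form_iff by (simp add: algebra_simps)
  moreover have "g u u - c * f u u = 0" using \<open>f u u \<noteq> 0\<close> by (simp add: c_def)
  ultimately have "g v w - c * f v w = 0" using invariant_form_eq_0 by blast
  then show ?thesis by (simp add: c_def)
qed

lemma span_X_word: "span (range (\<lambda>bs. X_word bs u)) = UNIV"
proof -
  let ?W = "span (range (\<lambda>bs. X_word bs u))"
  have "X b ` ?W \<subseteq> ?W" for b
  proof -
    have "X b ` ?W = span (X b ` range (\<lambda>bs. X_word bs u))"
      by (simp add: module_hom.span_image[OF X_hom])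
    also have "\<dots> \<subseteq> ?W"
      by (rule span_mono) (auto intro: range_eqI[of _ _ "b # _"])
    finally show ?thesis .
  qed
  moreover have "u \<in> ?W" by (rule span_base) (rule range_eqI[of _ _ "[]"], simp)
  ultimately show ?thesis using irreducible[of ?W] u_nonzero by auto
qed

lemma invariant_form_exists: "\<exists>f. invariant_form f \<and> f u u = 1"
proof -
  obtain B where B: "B \<subseteq> range (\<lambda>bs. X_word bs u)" "independent B" "range (\<lambda>bs. X_word bs u) \<subseteq> span B"
    using maximal_independent_subset by blast
  have span_B: "v \<in> span B" for v
    using span_minimal[OF B(3)] span_X_word by auto
  have "\<forall>b\<in>B. \<exists>bs. X_word bs u = b" using B(1) by auto
  then obtain w where w: "\<And>b. b \<in> B \<Longrightarrow> X_word (w b) u = b" by metis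
  define R where "R = representation B"
  \<comment> \<open>Expanding \<open>v\<close> in a basis of word vectors makes \<open>f\<close>
    linear in \<open>x\<close> at once; \<open>f_X_word\<close> then shows that the choice of basis
    and words is immaterial.\<close>
  define f where "f x v = (\<Sum>b | R v b \<noteq> 0. R v b * \<phi> (X_word (rev (w b)) x))" for x v
  have f_X_word: "f (X_word bs u) v = \<phi> (X_word (rev bs) v)" for bs v
  proof -
    have "\<phi> (X_word (rev (w b)) (X_word bs u)) = \<phi> (X_word (rev bs) b)" if "R v b \<noteq> 0" for b
      using \<phi>_X_word_rev[of "rev bs @ w b"] w[of b] representation_ne_zero[of B v b] that
      by (simp add: X_word_append R_def)
    then have "f (X_word bs u) v = (\<Sum>b | R v b \<noteq> 0. R v b * \<phi> (X_word (rev bs) b))"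
      by (simp add: f_def)
    also have "\<dots> = \<phi> (X_word (rev bs) (\<Sum>b | R v b \<noteq> 0. scale (R v b) b))"
      by (simp add: X_word_sum X_word_scale \<phi>_sum \<phi>_scale)
    also have "\<dots> = \<phi> (X_word (rev bs) v)"
      by (simp add: R_def sum_nonzero_representation_eq B(2) span_B)
    finally show ?thesis .
  qed
  have left: "f (x + y) z = f x z + f y z" "f (scale c x) z = c * f x z" for x y z c
    by (simp_all add: f_def X_word_add X_word_scale \<phi>_add \<phi>_scale algebra_simps sum.distrib sum_distrib_left)
  have extend: "P x" if "P 0" "\<And>x y. P x \<Longrightarrow> P y \<Longrightarrow> P (x + y)" "\<And>c x. P x \<Longrightarrow> P (scale c x)"
    "\<And>bs. P (X_word bs u)" for P x
  proof -
    have "x \<in> span (range (\<lambda>bs. X_word bs u))" using span_X_word by simp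
    then show ?thesis
      by (induction rule: span_induct_alt) (auto intro: that)
  qed
  have f0: "f 0 z = 0" for z using left(2)[of 0 0 z] by simp
  \<comment> \<open>For word vectors \<open>z\<close> this follows from \<open>f_X_word\<close>;
    \<open>extend\<close> passes to all \<open>z\<close>.\<close>
  have right: "f z (x + y) = f z x + f z y" "f z (scale c x) = c * f z x" for x y z c
    by (rule extend[of _ z]; simp add: f0 left f_X_word X_word_add X_word_scale \<phi>_add \<phi>_scale algebra_simps)+
  have inv: "f (X b x) y = f x (X b y)" for b x y
  proof (rule extend[of _ x])
    show "f (X b (X_word bs u)) y = f (X_word bs u) (X b y)" for bs
      using f_X_word[of "b # bs" y] f_X_word[of bs "X b y"] by (simp add: X_word_append)
  qed (simp_all add: f0 left X_add X_scale X_zero)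
  have "f u u = 1" using f_X_word[of "[]" u] by (simp add: \<phi>_u)
  moreover have "invariant_form f" unfolding invariant_form_iff using left right inv by blast
  ultimately show ?thesis by blast
qed

end

section \<open>The system of a sharp tridiagonal pair\<close>

text \<open>\<open>Q\<close> is the product of the operators \<open>A - \<theta> j\<close>, recorded
  only through its action on eigenvectors.\<close>

lemma polynomial_in_map_exists:
  fixes s :: "'k::field \<Rightarrow> 'v::ab_group_add \<Rightarrow> 'v"
  assumes "vector_space s" and A: "module_hom s s A" and "finite J"
  shows "\<exists>Q. module_hom s s Q \<and> (\<forall>v t. A v = s t v \<longrightarrow> Q v = s (\<Prod>j\<in>J. t - \<theta> j) v)"
proof -
  interpret vector_space s by fact
  show ?thesis using \<open>finite J\<close>
  proof (induction J rule: finite_induct)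
    case empty
    show ?case by (rule exI[of _ "\<lambda>v. v"]) (simp add: module_hom_iff module_axioms)
  next
    case (insert j J)
    then obtain Q where Q: "module_hom s s Q"
      and eig: "\<And>v t. A v = s t v \<Longrightarrow> Q v = s (\<Prod>j\<in>J. t - \<theta> j) v"
      by blast
    interpret A: module_hom s s A by fact
    interpret Q: module_hom s s Q by fact
    have "module_hom s s (\<lambda>v. Q (A v) - s (\<theta> j) (Q v))"
      by (simp add: module_hom_iff module_axioms A.add A.scale Q.add Q.scale algebra_simps)
    moreover have "Q (A v) - s (\<theta> j) (Q v) = s (\<Prod>j\<in>insert j J. t - \<theta> j) v" if "A v = s t v" for v t
      using insert.hyps eig[OF that] that by (simp add: Q.scale algebra_simps)
    ultimately show ?case by blast
  qed
qed

text \<open>Lagrange interpolation: \<open>P i\<close> is the product of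
  \<open>A - \<theta> j\<close> over \<open>j \<noteq> i\<close>, divided by its value
  \<open>q i (\<theta> i)\<close> at the eigenvalue.\<close>

lemma eigenspace_projections:
  fixes s :: "'k::field \<Rightarrow> 'v::ab_group_add \<Rightarrow> 'v" and U :: "nat \<Rightarrow> 'v set"
  assumes vs: "vector_space s" and A: "module_hom s s A" and diag: "diagonalizable s A"
    and bij: "bij_betw U {0..d} (eigenspaces s A)"
  obtains \<theta> P where "inj_on \<theta> {..d}"
    and "\<And>i v. i \<le> d \<Longrightarrow> v \<in> U i \<longleftrightarrow> A v = s (\<theta> i) v"
    and "\<And>i. module_hom s s (P i)"
    and "\<And>i v. i \<le> d \<Longrightarrow> P i v \<in> U i"
    and "\<And>i j v. i \<le> d \<Longrightarrow> j \<le> d \<Longrightarrow> i \<noteq> j \<Longrightarrow> v \<in> U j \<Longrightarrow> P i v = 0"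
    and "\<And>v. (\<Sum>i\<le>d. P i v) = v"
proof -
  interpret vector_space s by fact
  interpret A: module_hom s s A by fact
  have "\<exists>t. U i = eigenspace s A t" if "i \<le> d" for i
    using bij_betwE[OF bij, rule_format, of i] that unfolding eigenspaces_def by auto
  then obtain \<theta> where \<theta>: "\<And>i. i \<le> d \<Longrightarrow> U i = eigenspace s A (\<theta> i)"
    by metis
  have U: "v \<in> U i \<longleftrightarrow> A v = s (\<theta> i) v" if "i \<le> d" for i v
    using \<theta>[OF that] by (simp add: eigenspace_def)
  have inj: "inj_on \<theta> {..d}"
  proof (rule inj_onI)
    fix i j assume "i \<in> {..d}" "j \<in> {..d}" "\<theta> i = \<theta> j"
    moreover from this have "U i = U j" using \<theta> by simp
    ultimately show "i = j" using bij by (auto simp: bij_betw_def inj_on_def)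
  qed
  have sub: "subspace (U i)" if "i \<le> d" for i
    by (rule subspaceI) (simp_all add: U[OF that] A.add A.scale scale_right_distrib scale_left_commute)
  define q where "q i t = (\<Prod>j\<in>{..d} - {i}. t - \<theta> j)" for i t
  have "\<forall>i. \<exists>Q. module_hom s s Q \<and> (\<forall>v t. A v = s t v \<longrightarrow> Q v = s (q i t) v)"
    unfolding q_def by (intro allI polynomial_in_map_exists[OF vs A]) simp
  then obtain Q where Q: "\<And>i. module_hom s s (Q i)"
    and eig: "\<And>i v t. A v = s t v \<Longrightarrow> Q i v = s (q i t) v"
    by metis
  define P where "P i v = s (inverse (q i (\<theta> i))) (Q i v)" for i v
  have q_ne: "q i (\<theta> i) \<noteq> 0" if "i \<le> d" for i
    using inj that by (auto simp: q_def inj_on_def)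
  have q_0: "q i (\<theta> j) = 0" if "j \<le> d" "i \<noteq> j" for i j
    using that by (auto simp: q_def)
  have P_hom: "module_hom s s (P i)" for i
    using module_hom.add[OF Q, of i] module_hom.scale[OF Q, of i]
    by (simp add: module_hom_iff module_axioms P_def scale_right_distrib mult.commute)
  have P_other: "P i v = 0" if "i \<le> d" "j \<le> d" "i \<noteq> j" "v \<in> U j" for i j v
    using that eig[of v "\<theta> j" i] by (simp add: P_def U q_0)
  have P_same: "P i v = v" if "i \<le> d" "v \<in> U i" for i v
    using that eig[of v "\<theta> i" i] q_ne by (simp add: P_def U)
  \<comment> \<open>Both properties hold on eigenvectors and survive linear combinations, so
    diagonalizability gives them everywhere.\<close>
  have "(\<Sum>i\<le>d. P i v) = v \<and> (\<forall>i\<le>d. P i v \<in> U i)" for v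
  proof -
    have "\<Union>(eigenspaces s A) = (\<Union>i\<le>d. U i)"
      using bij by (auto simp: bij_betw_def atMost_atLeast0)
    then have "v \<in> span (\<Union>i\<le>d. U i)" using diag by (simp add: diagonalizable_def)
    then show ?thesis
    proof (induction rule: span_induct_alt)
      case base
      then show ?case by (simp add: module_hom.zero[OF P_hom] subspace_0 sub)
    next
      case (step c x y)
      then obtain j where j: "j \<le> d" "x \<in> U j" by auto
      have x: "P i x = (if i = j then x else 0)" if "i \<le> d" for i
        using that j P_other P_same by auto
      then have "(\<Sum>i\<le>d. P i x) = x" using j(1) by simp
      moreover have "P i x \<in> U i" if "i \<le> d" for i
        using that x[OF that] j(2) by (simp add: subspace_0 sub)
      moreover have "P i (s c x + y) = s c (P i x) + P i y" for i
        by (simp add: module_hom.add[OF P_hom] module_hom.scale[OF P_hom])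
      ultimately show ?case using step(2) sub
        by (auto simp: sum.distrib subspace_add subspace_scale simp flip: scale_sum_right)
    qed
  qed
  then show ?thesis using that[of \<theta> P] inj U P_hom P_other by blast
qed

lemma tridiagonal_projections:
  fixes s :: "'k::field \<Rightarrow> 'v::ab_group_add \<Rightarrow> 'v"
  assumes "\<And>i. module_hom s s (P i)"
    and "\<And>i v. i \<le> d \<Longrightarrow> P i v \<in> U i"
    and other: "\<And>i j v. i \<le> d \<Longrightarrow> j \<le> d \<Longrightarrow> i \<noteq> j \<Longrightarrow> v \<in> U j \<Longrightarrow> P i v = 0"
    and ord: "tridiagonal_ordering s A B d U"
    and "i \<le> d" "j \<le> d" "1 < \<bar>int i - int j\<bar>"
  shows "P i (B (P j v)) = 0"
proof -
  have "B (P j v) \<in> sum3 (if j = 0 then {0} else U (j - 1)) (U j) (if j = d then {0} else U (j + 1))"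
    using ord assms(2) \<open>j \<le> d\<close> unfolding tridiagonal_ordering_def by blast
  then obtain x y z where xyz: "B (P j v) = x + y + z"
    "x \<in> (if j = 0 then {0} else U (j - 1))" "y \<in> U j" "z \<in> (if j = d then {0} else U (j + 1))"
    unfolding sum3_def by blast
  have zero: "P i 0 = 0" using assms(1) by (rule module_hom.zero)
  have "P i x = 0"
    using xyz(2) zero other[of i "j - 1" x] assms(5-7) by (auto split: if_splits)
  moreover have "P i y = 0" using xyz(3) other[of i j y] assms(5-7) by auto
  moreover have "P i z = 0"
    using xyz(4) zero other[of i "j + 1" z] assms(5-7) by (auto split: if_splits)
  ultimately show ?thesis by (simp add: xyz(1) module_hom.add[OF assms(1)])
qed

text \<open>\<open>\<phi>\<close> is the coordinate of \<open>E v\<close> along a basis vector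
  \<open>u\<close> of \<open>W\<close>; cancelling the nonzero \<open>u\<close> gives its
  linearity.\<close>

lemma rank_one_functional:
  fixes s :: "'k::field \<Rightarrow> 'v::ab_group_add \<Rightarrow> 'v"
  assumes "vector_space s" and hom: "module_hom s s E"
    and "vector_space.dim s W = 1" and range: "\<And>v. E v \<in> W" and id: "\<And>v. v \<in> W \<Longrightarrow> E v = v"
  obtains u \<phi> where "module_hom s (*) \<phi>" "\<And>v. E v = s (\<phi> v) u" "\<phi> u = 1"
proof -
  interpret vector_space s by fact
  interpret E: module_hom s s E by fact
  obtain B where B: "B \<subseteq> W" "independent B" "W \<subseteq> span B" "card B = 1"
    using basis_exists[of W] assms(3) by metis
  then obtain u where u: "B = {u}" by (auto simp: card_1_singleton_iff)
  have "u \<noteq> 0" using B(2) dependent_zero[of B] u by auto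
  have "\<exists>c. E v = s c u" for v
    using range[of v] B(3) u by (auto simp: span_singleton)
  then obtain \<phi> where \<phi>: "\<And>v. E v = s (\<phi> v) u" by metis
  have "s (\<phi> (x + y)) u = s (\<phi> x + \<phi> y) u" for x y
    by (simp add: scale_left_distrib E.add flip: \<phi>)
  moreover have "s (\<phi> (s c x)) u = s (c * \<phi> x) u" for c x
    by (simp add: E.scale flip: \<phi> scale_scale)
  moreover have "module ((*) :: 'k \<Rightarrow> 'k \<Rightarrow> 'k)" by unfold_locales (simp_all add: algebra_simps)
  ultimately have "module_hom s (*) \<phi>"
    using \<open>u \<noteq> 0\<close> by (simp add: module_hom_iff module_axioms)
  moreover have "s (\<phi> u) u = s 1 u" using id[of u] B(1) u \<phi>[of u] by simp
  then have "\<phi> u = 1" using \<open>u \<noteq> 0\<close> by (simp only: scale_cancel_right) simp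
  ultimately show ?thesis using that \<phi> by blast
qed

theorem theorem1p4:
  fixes scale :: "'k::field \<Rightarrow> 'v::ab_group_add \<Rightarrow> 'v"
    and Basis :: "'v set"
    and A Astar :: "'v \<Rightarrow> 'v"
  assumes "finite_dimensional_vector_space scale Basis"
    and "vector_space.dim scale (UNIV :: 'v set) > 0"
    and "sharp_tridiagonal_pair scale A Astar"
  shows "\<exists>f :: 'v \<Rightarrow> 'v \<Rightarrow> 'k.
           nonzero_invariant_form scale A Astar f \<and>
           (\<forall>g. nonzero_invariant_form scale A Astar g \<longrightarrow>
              (\<exists>c. c \<noteq> 0 \<and> (\<forall>u v. g u v = c * f u v))) \<and>
           nondegenerate_form f \<and>
           symmetric_form f"
proof -
  have vs: "vector_space scale" using assms(1) by (simp add: finite_dimensional_vector_space_def)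
  interpret vector_space scale by fact
  have pair: "tridiagonal_pair scale A Astar" using assms(3) by (simp add: sharp_tridiagonal_pair_def)
  have A: "module_hom scale scale A" and Astar: "module_hom scale scale Astar"
    and diag: "diagonalizable scale A" "diagonalizable scale Astar"
    and irr: "\<And>W. subspace W \<Longrightarrow> A ` W \<subseteq> W \<Longrightarrow> Astar ` W \<subseteq> W \<Longrightarrow> W = {0} \<or> W = UNIV"
    using pair unfolding tridiagonal_pair_def linear_iff_module_hom by blast+
  obtain d U where U: "tridiagonal_ordering scale A Astar d U" "dim (U 0) = 1"
    using assms(3) unfolding sharp_tridiagonal_pair_def by blast
  obtain d' U' where U': "tridiagonal_ordering scale Astar A d' U'"
    using pair unfolding tridiagonal_pair_def by blast
  have bij: "bij_betw U {0..d} (eigenspaces scale A)"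
    and bij': "bij_betw U' {0..d'} (eigenspaces scale Astar)"
    using U(1) U' unfolding tridiagonal_ordering_def by blast+
  obtain \<theta> P where inj: "inj_on \<theta> {..d}"
    and eig: "\<And>i v. i \<le> d \<Longrightarrow> v \<in> U i \<longleftrightarrow> A v = scale (\<theta> i) v"
    and hom: "\<And>i. module_hom scale scale (P i)"
    and P: "\<And>i v. i \<le> d \<Longrightarrow> P i v \<in> U i"
    and other: "\<And>i j v. i \<le> d \<Longrightarrow> j \<le> d \<Longrightarrow> i \<noteq> j \<Longrightarrow> v \<in> U j \<Longrightarrow> P i v = 0"
    and sum: "\<And>v. (\<Sum>i\<le>d. P i v) = v"
    by (rule eigenspace_projections[OF vs A diag(1) bij], rule that)
  obtain \<theta>' P' where inj': "inj_on \<theta>' {..d'}"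
    and eig': "\<And>i v. i \<le> d' \<Longrightarrow> v \<in> U' i \<longleftrightarrow> Astar v = scale (\<theta>' i) v"
    and hom': "\<And>i. module_hom scale scale (P' i)"
    and P': "\<And>i v. i \<le> d' \<Longrightarrow> P' i v \<in> U' i"
    and other': "\<And>i j v. i \<le> d' \<Longrightarrow> j \<le> d' \<Longrightarrow> i \<noteq> j \<Longrightarrow> v \<in> U' j \<Longrightarrow> P' i v = 0"
    and sum': "\<And>v. (\<Sum>i\<le>d'. P' i v) = v"
    by (rule eigenspace_projections[OF vs Astar diag(2) bij'], rule that)
  have P0: "P 0 v = v" if "v \<in> U 0" for v
  proof -
    have "v = (\<Sum>i\<le>d. P i v)" by (simp add: sum)
    also have "\<dots> = (\<Sum>i\<le>d. if i = 0 then P 0 v else 0)"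
      using that by (intro sum.cong) (auto intro: other)
    finally show ?thesis by simp
  qed
  \<comment> \<open>Sharpness enters here: \<open>P 0\<close> projects onto the line
    \<open>U 0\<close>.\<close>
  obtain u \<phi> where \<phi>: "module_hom scale (*) \<phi>" "\<And>v. P 0 v = scale (\<phi> v) u" "\<phi> u = 1"
    using rank_one_functional[OF vs hom[of 0] U(2)] P P0 by (metis zero_le)
  let ?X = "\<lambda>b. if b then A else Astar" and ?P = "\<lambda>b. if b then P else P'"
    and ?D = "\<lambda>b. if b then d else d'" and ?\<theta> = "\<lambda>b. if b then \<theta> else \<theta>'"
  interpret irreducible_tridiagonal_system scale ?X ?P ?D ?\<theta> u \<phi>
  proof (intro irreducible_tridiagonal_system.intro tridiagonal_system.intro vs
      tridiagonal_system_axioms.intro irreducible_tridiagonal_system_axioms.intro)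
    fix b i j v
    show "module_hom scale scale (?X b)" "module_hom scale scale (?P b i)"
      using A Astar hom hom' by simp_all
    show "inj_on (?\<theta> b) {..?D b}" using inj inj' by simp
    show "(\<Sum>i\<le>?D b. ?P b i v) = v" using sum sum' by simp
    show "?X b (?P b i v) = scale (?\<theta> b i) (?P b i v)" if "i \<le> ?D b"
      using that eig[of i "P i v"] eig'[of i "P' i v"] P[of i v] P'[of i v] by (cases b) auto
    show "?P b i (?P b j v) = 0" if "i \<le> ?D b" "j \<le> ?D b" "i \<noteq> j"
      using that P P' other[of i j] other'[of i j] by (cases b) auto
    show "?P b i (?X (\<not> b) (?P b j v)) = 0"
      if "i \<le> ?D b" "j \<le> ?D b" "1 < \<bar>int i - int j\<bar>"
      using that tridiagonal_projections[OF hom P other U(1)]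
        tridiagonal_projections[OF hom' P' other' U'] by (cases b) auto
    show "W = {0} \<or> W = UNIV" if "subspace W" "\<And>b. ?X b ` W \<subseteq> W" for W
      using irr[OF that(1)] that(2)[of True] that(2)[of False] by simp
  qed (simp_all add: \<phi>)
  have inv: "nonzero_invariant_form scale A Astar f \<longleftrightarrow> invariant_form f \<and> (\<exists>x y. f x y \<noteq> 0)" for f
    unfolding nonzero_invariant_form_def invariant_form_def by (auto simp: all_bool_eq)
  obtain f where f: "invariant_form f" "f u u = 1" using invariant_form_exists by blast
  then have ne: "f u u \<noteq> 0" by simp
  have "\<exists>c. c \<noteq> 0 \<and> (\<forall>v w. g v w = c * f v w)" if g: "nonzero_invariant_form scale A Astar g" for g
  proof (intro exI conjI allI)
    \<comment> \<open>This fixes the witness left open by \<open>exI\<close>; it is nonzero, as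
      otherwise \<open>g\<close> would vanish.\<close>
    show "g v w = g u u / f u u * f v w" for v w
      using invariant_form_unique[OF f(1) _ ne] g inv by blast
    then show "g u u / f u u \<noteq> 0" using g inv by (metis mult_zero_left)
  qed
  moreover have "nondegenerate_form f" using invariant_form_nondegenerate[OF f(1) ne] .
  moreover have "symmetric_form f"
    unfolding symmetric_form_def using invariant_form_symmetric[OF f(1)] by blast
  ultimately show ?thesis using inv f(1) ne by blast
qed

end
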